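(* Let $A$ be finite-dimensional, $(A,\dashv,\vdash)$ a Novikov dialgebra, $(\bar A=\mathbf{k}[\partial]A,[\cdot_\lambda\cdot])$ the Leibniz conformal algebra corresponding to $(A,\dashv,\vdash)$, and let $r\in A\otimes A$ be symmetric. Then $r$ is a solution of the classical Leibniz conformal Yang-Baxter equation (CLCYBE) in $\bar A$ if and only if $r$ is a solution of the classical duplicate Novikov Yang-Baxter equation (CDNYBE) in $A$.
   Context: $\mathbf{k}$ is a field of characteristic zero; tensors are over $\mathbf{k}$; $\tau(a\otimes b)=b\otimes a$; $r$ is symmetric if $\tau r=r$. Novikov dialgebra $(A,\dashv,\vdash)$: a vector space with two binary operations such that for all $a,b,c$: $(a\vdash b)\dashv c=(a\vdash c)\vdash b=(a\dashv c)\vdash b$; $a\dashv(b\dashv c)=a\dashv(b\vdash c)$; $(a\dashv b)\dashv c=(a\dashv c)\dashv b$; $(a\dashv b)\dashv c-a\dashv(b\dashv c)=(b\vdash a)\dashv c-b\vdash(a\dashv c)$; $(a\vdash b)\vdash c-a\vdash(b\vdash c)=(b\vdash a)\vdash c-b\vdash(a\vdash c)$. Corresponding Leibniz conformal algebra: $\bar A=\mathbf{k}[\partial]\otimes A$ with $[a_\lambda b]=\partial(b\dashv a)+\lambda(a\vdash b+b\dashv a)$ for $a,b\in A$, extended by $[\partial a_\lambda b]=-\lambda[a_\lambda b]$, $[a_\lambda\partial b]=(\lambda+\partial)[a_\lambda b]$. (A Leibniz conformal algebra is a $\mathbf{k}[\partial]$-module with a $\lambda$-bracket obeying these sesquilinearity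 rules and $[a_\lambda[b_\mu c]]=[[a_\lambda b]_{\lambda+\mu}c]+[b_\mu[a_\lambda c]]$.) CDNYBE in $A$: for $r=\sum_ia_i\otimes b_i$, $N(r)=0$ where $$N(r)=\sum_{i,j}a_i\vdash a_j\otimes b_i\otimes b_j+a_i\otimes(b_i\vdash a_j-b_i\dashv a_j)\otimes b_j+a_i\otimes a_j\otimes(b_j\vdash b_i+b_i\dashv b_j).$$ CLCYBE in a Leibniz conformal algebra $Q$: let $\partial_1,\partial_2,\partial_3$ be $\partial$ acting on the factors of $Q^{\otimes3}$ and $\partial^{\otimes^3}=\partial_1+\partial_2+\partial_3$. For $r=\sum_ia_i\otimes b_i\in Q\otimes Q$ put $$[[r,r]]=\sum_{i,j}[{a_i}_\mu a_j]\otimes b_i\otimes b_j|_{\mu=\partial_2}+\sum_{i,j}a_i\otimes a_j\otimes[{b_j}_\mu b_i]|_{\mu=\partial_2}-\sum_{i,j}a_i\otimes[{b_i}_\mu a_j]\otimes b_j|_{\mu=\partial_1}-\sum_{i,j}a_i\otimes[{a_j}_\mu b_i]\otimes b_j|_{\mu=-\partial_1-\partial_2},$$ where one computes each polynomial in $\mu$ first and then lets the substituted operator act on its coefficients in $Q^{\otimes3}$. $r$ is a solution of the CLCYBE in $Q$ if $[[r,r]]\in\partial^{\otimes^3}(Q\otimes Q\otimes Q)$. *)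

theory Defs
  imports
    "HOL-Library.Poly_Mapping"
    "HOL-Computational_Algebra.Polynomial"
begin

section \<open>Novikov dialgebras\<close>

locale novikov_dialgebra = vector_space scale
  for scale :: "'k::field_char_0 \<Rightarrow> 'a::ab_group_add \<Rightarrow> 'a" +
  fixes left :: "'a \<Rightarrow> 'a \<Rightarrow> 'a" (infixl "\<stileturn>" 70)
    and right :: "'a \<Rightarrow> 'a \<Rightarrow> 'a" (infixl "\<turnstile>" 70)
  assumes left_linear1: "Vector_Spaces.linear scale scale (\<lambda>a. a \<stileturn> b)"
    and left_linear2: "Vector_Spaces.linear scale scale (\<lambda>b. a \<stileturn> b)"
    and right_linear1: "Vector_Spaces.linear scale scale (\<lambda>a. a \<turnstile> b)"
    and right_linear2: "Vector_Spaces.linear scale scale (\<lambda>b. a \<turnstile> b)"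
    and right_left: "(a \<turnstile> b) \<stileturn> c = (a \<turnstile> c) \<turnstile> b"
    and right_right: "(a \<turnstile> c) \<turnstile> b = (a \<stileturn> c) \<turnstile> b"
    and left_inner: "a \<stileturn> (b \<stileturn> c) = a \<stileturn> (b \<turnstile> c)"
    and left_comm: "(a \<stileturn> b) \<stileturn> c = (a \<stileturn> c) \<stileturn> b"
    and left_assoc: "(a \<stileturn> b) \<stileturn> c - a \<stileturn> (b \<stileturn> c) = (b \<turnstile> a) \<stileturn> c - b \<turnstile> (a \<stileturn> c)"
    and right_assoc: "(a \<turnstile> b) \<turnstile> c - a \<turnstile> (b \<turnstile> c) = (b \<turnstile> a) \<turnstile> c - b \<turnstile> (a \<turnstile> c)"


section \<open>Tensor products over a field\<close>

text \<open>
  The tensor powers of a vector space with scalar multiplication \<open>scale\<close> are the quotients of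
  the free vector space on pairs (triples) by the span of the multilinearity relations.  A tensor
  is an element of this quotient, that is, a coset of formal sums.
\<close>

definition fscale :: "'k::field \<Rightarrow> ('x \<Rightarrow>\<^sub>0 'k) \<Rightarrow> ('x \<Rightarrow>\<^sub>0 'k)" where
  "fscale c x = Poly_Mapping.map (\<lambda>d. c * d) x"

definition lin_ext :: "('x \<Rightarrow> ('y \<Rightarrow>\<^sub>0 'k)) \<Rightarrow> ('x \<Rightarrow>\<^sub>0 'k::field) \<Rightarrow> ('y \<Rightarrow>\<^sub>0 'k)" where
  "lin_ext f x = (\<Sum>p\<in>Poly_Mapping.keys x. fscale (Poly_Mapping.lookup x p) (f p))"

text \<open>
  If \<open>x = \<Sum>\<^sub>i x\<^sub>i p\<^sub>i\<close> is a formal sum, then \<open>quad_ext f x = \<Sum>\<^sub>i\<^sub>,\<^sub>j x\<^sub>i x\<^sub>j f(p\<^sub>i, p\<^sub>j)\<close>.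
\<close>

definition quad_ext :: "('x \<Rightarrow> 'x \<Rightarrow> ('y \<Rightarrow>\<^sub>0 'k)) \<Rightarrow> ('x \<Rightarrow>\<^sub>0 'k::field) \<Rightarrow> ('y \<Rightarrow>\<^sub>0 'k)" where
  "quad_ext f x = (\<Sum>p\<in>Poly_Mapping.keys x. \<Sum>q\<in>Poly_Mapping.keys x.
     fscale (Poly_Mapping.lookup x p * Poly_Mapping.lookup x q) (f p q))"

definition e2 :: "'v \<Rightarrow> 'v \<Rightarrow> ('v \<times> 'v) \<Rightarrow>\<^sub>0 'k::field" where
  "e2 a b = Poly_Mapping.single (a, b) 1"

definition e3 :: "'v \<Rightarrow> 'v \<Rightarrow> 'v \<Rightarrow> ('v \<times> 'v \<times> 'v) \<Rightarrow>\<^sub>0 'k::field" where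
  "e3 a b c = Poly_Mapping.single (a, b, c) 1"

definition null2 :: "('k::field \<Rightarrow> 'v::ab_group_add \<Rightarrow> 'v) \<Rightarrow> (('v \<times> 'v) \<Rightarrow>\<^sub>0 'k) set" where
  "null2 scale = module.span fscale
     ({e2 (a + a') b - e2 a b - e2 a' b | a a' b. True} \<union>
      {e2 a (b + b') - e2 a b - e2 a b' | a b b'. True} \<union>
      {e2 (scale t a) b - fscale t (e2 a b) | t a b. True} \<union>
      {e2 a (scale t b) - fscale t (e2 a b) | t a b. True})"

definition null3 :: "('k::field \<Rightarrow> 'v::ab_group_add \<Rightarrow> 'v) \<Rightarrow> (('v \<times> 'v \<times> 'v) \<Rightarrow>\<^sub>0 'k) set" where
  "null3 scale = module.span fscale
     ({e3 (a + a') b c - e3 a b c - e3 a' b c | a a' b c. True} \<union>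
      {e3 a (b + b') c - e3 a b c - e3 a b' c | a b b' c. True} \<union>
      {e3 a b (c + c') - e3 a b c - e3 a b c' | a b c c'. True} \<union>
      {e3 (scale t a) b c - fscale t (e3 a b c) | t a b c. True} \<union>
      {e3 a (scale t b) c - fscale t (e3 a b c) | t a b c. True} \<union>
      {e3 a b (scale t c) - fscale t (e3 a b c) | t a b c. True})"

definition cong2 :: "('k::field \<Rightarrow> 'v::ab_group_add \<Rightarrow> 'v) \<Rightarrow> (('v \<times> 'v) \<Rightarrow>\<^sub>0 'k) rel" where
  "cong2 scale = {(x, y). x - y \<in> null2 scale}"

definition cong3 :: "('k::field \<Rightarrow> 'v::ab_group_add \<Rightarrow> 'v) \<Rightarrow> (('v \<times> 'v \<times> 'v) \<Rightarrow>\<^sub>0 'k) rel" where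
  "cong3 scale = {(x, y). x - y \<in> null3 scale}"

definition tensor2 :: "('k::field \<Rightarrow> 'v::ab_group_add \<Rightarrow> 'v) \<Rightarrow> (('v \<times> 'v) \<Rightarrow>\<^sub>0 'k) set set" where
  "tensor2 scale = UNIV // cong2 scale"

definition tensor3 :: "('k::field \<Rightarrow> 'v::ab_group_add \<Rightarrow> 'v) \<Rightarrow> (('v \<times> 'v \<times> 'v) \<Rightarrow>\<^sub>0 'k) set set" where
  "tensor3 scale = UNIV // cong3 scale"

text \<open>
  A map \<open>f\<close> on formal sums that respects the congruences induces the map
  \<open>quot_lift R f\<close> on tensors, where \<open>R\<close> is the congruence on the target side.
\<close>

definition quot_lift :: "'y rel \<Rightarrow> ('x \<Rightarrow> 'y) \<Rightarrow> 'x set \<Rightarrow> 'y set" where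
  "quot_lift R f X = (\<Union>x\<in>X. R `` {f x})"

lemma vector_space_fscale: "vector_space (fscale :: 'k::field \<Rightarrow> ('x \<Rightarrow>\<^sub>0 'k) \<Rightarrow> _)"
proof
  have l: "Poly_Mapping.lookup (fscale c x) p = c * Poly_Mapping.lookup x p"
    for c and x :: "'x \<Rightarrow>\<^sub>0 'k" and p
    by (simp add: fscale_def Poly_Mapping.map.rep_eq when_def)
  fix a b :: 'k and x y :: "'x \<Rightarrow>\<^sub>0 'k"
  show "fscale a (x + y) = fscale a x + fscale a y"
    by (intro poly_mapping_eqI) (simp add: l lookup_add algebra_simps)
  show "fscale (a + b) x = fscale a x + fscale b x"
    by (intro poly_mapping_eqI) (simp add: l lookup_add algebra_simps)
  show "fscale a (fscale b x) = fscale (a * b) x"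
    by (intro poly_mapping_eqI) (simp add: l algebra_simps)
  show "fscale 1 x = x"
    by (intro poly_mapping_eqI) (simp add: l)
qed

definition tensor_symmetric ::
    "('k::field \<Rightarrow> 'v::ab_group_add \<Rightarrow> 'v) \<Rightarrow> (('v \<times> 'v) \<Rightarrow>\<^sub>0 'k) set \<Rightarrow> bool" where
  "tensor_symmetric scale r \<longleftrightarrow>
     quot_lift (cong2 scale) (lin_ext (\<lambda>(a, b). e2 b a)) r = r"


section \<open>The classical duplicate Novikov Yang--Baxter equation\<close>

definition cdn_term ::
    "('a::ab_group_add \<Rightarrow> 'a \<Rightarrow> 'a) \<Rightarrow> ('a \<Rightarrow> 'a \<Rightarrow> 'a) \<Rightarrow> 'a \<times> 'a \<Rightarrow> 'a \<times> 'a \<Rightarrow>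
     (('a \<times> 'a \<times> 'a) \<Rightarrow>\<^sub>0 'k::field)" where
  "cdn_term left right = (\<lambda>(ai, bi) (aj, bj).
       e3 (right ai aj) bi bj
     + e3 ai (right bi aj - left bi aj) bj
     + e3 ai aj (right bj bi + left bi bj))"

definition CDN :: "('k::field \<Rightarrow> 'a::ab_group_add \<Rightarrow> 'a) \<Rightarrow> ('a \<Rightarrow> 'a \<Rightarrow> 'a) \<Rightarrow> ('a \<Rightarrow> 'a \<Rightarrow> 'a) \<Rightarrow>
     (('a \<times> 'a) \<Rightarrow>\<^sub>0 'k) set \<Rightarrow> (('a \<times> 'a \<times> 'a) \<Rightarrow>\<^sub>0 'k) set" where
  "CDN scale left right = quot_lift (cong3 scale) (quad_ext (cdn_term left right))"

definition CDNYBE :: "('k::field \<Rightarrow> 'a::ab_group_add \<Rightarrow> 'a) \<Rightarrow> ('a \<Rightarrow> 'a \<Rightarrow> 'a) \<Rightarrow> ('a \<Rightarrow> 'a \<Rightarrow> 'a) \<Rightarrow>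
     (('a \<times> 'a) \<Rightarrow>\<^sub>0 'k) set \<Rightarrow> bool" where
  "CDNYBE scale left right r \<longleftrightarrow> CDN scale left right r = cong3 scale `` {0}"


section \<open>The classical Leibniz conformal Yang--Baxter equation\<close>

text \<open>
  \<open>Q\<close> is given by its scalar multiplication, the action \<open>D\<close> of the derivation variable, and the
  bracket \<open>br\<close>; here \<open>br a b :: 'q poly\<close> is the polynomial \<open>[a\<^sub>\<mu> b]\<close> in \<open>\<mu>\<close> with coefficients
  in \<open>Q\<close>.

  For a linear operator \<open>T\<close> and a polynomial \<open>P = \<Sum>\<^sub>k \<mu>\<^sup>k c\<^sub>k\<close>, \<open>subst_op T P ins\<close> is
  \<open>\<Sum>\<^sub>k \<mu>\<^sup>k ins(c\<^sub>k)\<close> at \<open>\<mu> = T\<close>, where \<open>ins\<close> inserts the coefficients into a triple tensor.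
\<close>

definition subst_op :: "('t \<Rightarrow> 't) \<Rightarrow> 'q::zero poly \<Rightarrow> ('q \<Rightarrow> 't) \<Rightarrow> 't::comm_monoid_add" where
  "subst_op T P ins = (\<Sum>k\<le>Polynomial.degree P. (T ^^ k) (ins (coeff P k)))"

definition d1 :: "('q \<Rightarrow> 'q) \<Rightarrow> (('q \<times> 'q \<times> 'q) \<Rightarrow>\<^sub>0 'k::field) \<Rightarrow> (('q \<times> 'q \<times> 'q) \<Rightarrow>\<^sub>0 'k)" where
  "d1 D = lin_ext (\<lambda>(a, b, c). e3 (D a) b c)"

definition d2 :: "('q \<Rightarrow> 'q) \<Rightarrow> (('q \<times> 'q \<times> 'q) \<Rightarrow>\<^sub>0 'k::field) \<Rightarrow> (('q \<times> 'q \<times> 'q) \<Rightarrow>\<^sub>0 'k)" where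
  "d2 D = lin_ext (\<lambda>(a, b, c). e3 a (D b) c)"

definition d3 :: "('q \<Rightarrow> 'q) \<Rightarrow> (('q \<times> 'q \<times> 'q) \<Rightarrow>\<^sub>0 'k::field) \<Rightarrow> (('q \<times> 'q \<times> 'q) \<Rightarrow>\<^sub>0 'k)" where
  "d3 D = lin_ext (\<lambda>(a, b, c). e3 a b (D c))"

definition clc_term :: "('q \<Rightarrow> 'q) \<Rightarrow> ('q \<Rightarrow> 'q \<Rightarrow> 'q::ab_group_add poly) \<Rightarrow>
     'q \<times> 'q \<Rightarrow> 'q \<times> 'q \<Rightarrow> (('q \<times> 'q \<times> 'q) \<Rightarrow>\<^sub>0 'k::field)" where
  "clc_term D br = (\<lambda>(ai, bi) (aj, bj).
       subst_op (d2 D) (br ai aj) (\<lambda>c. e3 c bi bj)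
     + subst_op (d2 D) (br bj bi) (\<lambda>c. e3 ai aj c)
     - subst_op (d1 D) (br bi aj) (\<lambda>c. e3 ai c bj)
     - subst_op (\<lambda>x. - d1 D x - d2 D x) (br aj bi) (\<lambda>c. e3 ai c bj))"

definition CLC :: "('k::field \<Rightarrow> 'q::ab_group_add \<Rightarrow> 'q) \<Rightarrow> ('q \<Rightarrow> 'q) \<Rightarrow> ('q \<Rightarrow> 'q \<Rightarrow> 'q poly) \<Rightarrow>
     (('q \<times> 'q) \<Rightarrow>\<^sub>0 'k) set \<Rightarrow> (('q \<times> 'q \<times> 'q) \<Rightarrow>\<^sub>0 'k) set" where
  "CLC scale D br = quot_lift (cong3 scale) (quad_ext (clc_term D br))"

definition CLCYBE :: "('k::field \<Rightarrow> 'q::ab_group_add \<Rightarrow> 'q) \<Rightarrow> ('q \<Rightarrow> 'q) \<Rightarrow> ('q \<Rightarrow> 'q \<Rightarrow> 'q poly) \<Rightarrow>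
     (('q \<times> 'q) \<Rightarrow>\<^sub>0 'k) set \<Rightarrow> bool" where
  "CLCYBE scale D br r \<longleftrightarrow>
     CLC scale D br r
       \<in> quot_lift (cong3 scale) (\<lambda>x. d1 D x + d2 D x + d3 D x) ` tensor3 scale"


section \<open>The Leibniz conformal algebra of a Novikov dialgebra\<close>

text \<open>
  The space \<open>k[\<partial>] \<otimes> A\<close> is represented by the type \<open>'a poly\<close> of polynomials in \<open>\<partial>\<close> with
  coefficients in \<open>A\<close>; the element \<open>\<partial>\<^sup>i \<otimes> a\<close> is \<open>monom a i\<close>, and \<open>\<partial>\<close> acts as \<open>pCons 0\<close>.
  In \<open>'a poly poly\<close> the outer variable is \<open>\<lambda>\<close> and the inner one is \<open>\<partial>\<close>.
\<close>

definition cur_scale :: "('k \<Rightarrow> 'a::ab_group_add \<Rightarrow> 'a) \<Rightarrow> 'k \<Rightarrow> 'a poly \<Rightarrow> 'a poly" where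
  "cur_scale scale t = map_poly (scale t)"

definition cur_D :: "'a::ab_group_add poly \<Rightarrow> 'a poly" where
  "cur_D p = pCons 0 p"

definition mult_lambda :: "'q::ab_group_add poly \<Rightarrow> 'q poly" where
  "mult_lambda P = pCons 0 P"

definition mult_D :: "'a::ab_group_add poly poly \<Rightarrow> 'a poly poly" where
  "mult_D P = map_poly cur_D P"

text \<open>The bracket \<open>[a\<^sub>\<lambda> b]\<close> for \<open>a, b\<close> in \<open>A\<close>.\<close>

definition bracket_gen ::
    "('a::ab_group_add \<Rightarrow> 'a \<Rightarrow> 'a) \<Rightarrow> ('a \<Rightarrow> 'a \<Rightarrow> 'a) \<Rightarrow> 'a \<Rightarrow> 'a \<Rightarrow> 'a poly poly" where
  "bracket_gen left right a b = [: cur_D [:left b a:], [:right a b + left b a:] :]"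

text \<open>
  The extension to \<open>k[\<partial>] \<otimes> A\<close> by
  \<open>[\<partial>\<^sup>i a\<^sub>\<lambda> \<partial>\<^sup>j b] = (-\<lambda>)\<^sup>i (\<lambda> + \<partial>)\<^sup>j [a\<^sub>\<lambda> b]\<close>.
\<close>

definition bracket ::
    "('a::ab_group_add \<Rightarrow> 'a \<Rightarrow> 'a) \<Rightarrow> ('a \<Rightarrow> 'a \<Rightarrow> 'a) \<Rightarrow> 'a poly \<Rightarrow> 'a poly \<Rightarrow> 'a poly poly" where
  "bracket left right p q =
     (\<Sum>i\<le>Polynomial.degree p. \<Sum>j\<le>Polynomial.degree q.
        ((\<lambda>P. - mult_lambda P) ^^ i)
          (((\<lambda>P. mult_lambda P + mult_D P) ^^ j) (bracket_gen left right (coeff p i) (coeff q j))))"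

definition cur_incl2 :: "('k::field \<Rightarrow> 'a::ab_group_add \<Rightarrow> 'a) \<Rightarrow>
     (('a \<times> 'a) \<Rightarrow>\<^sub>0 'k) set \<Rightarrow> (('a poly \<times> 'a poly) \<Rightarrow>\<^sub>0 'k) set" where
  "cur_incl2 scale = quot_lift (cong2 (cur_scale scale)) (lin_ext (\<lambda>(a, b). e2 [:a:] [:b:]))"

lemma bracket_const: "bracket left right [:a:] [:b:] = bracket_gen left right a b"
  by (simp add: bracket_def)

lemma mult_D_add: "mult_D (P + Q) = mult_D P + mult_D Q"
  by (intro poly_eqI) (simp add: mult_D_def coeff_map_poly cur_D_def)

lemma mult_D_lambda: "mult_D (mult_lambda P) = mult_lambda (mult_D P)"
  by (intro poly_eqI)
    (simp add: mult_D_def mult_lambda_def coeff_map_poly cur_D_def coeff_pCons split: nat.split)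

lemma mult_D_minus: "mult_D (- P) = - mult_D P"
  by (intro poly_eqI) (simp add: mult_D_def coeff_map_poly cur_D_def)

lemma mult_lambda_add: "mult_lambda (P + Q) = mult_lambda P + mult_lambda Q"
  by (simp add: mult_lambda_def)

lemma funpow_additive:
  fixes F :: "'b::ab_group_add \<Rightarrow> 'b"
  assumes "\<And>x y. F (x + y) = F x + F y"
  shows "(F ^^ n) 0 = 0"
proof -
  have "F 0 = 0" using assms[of 0 0] by simp
  then show ?thesis by (induction n) auto
qed

lemma additive_sum:
  fixes F :: "'b::ab_group_add \<Rightarrow> 'c::ab_group_add"
  assumes "\<And>x y. F (x + y) = F x + F y"
  shows "F (sum g I) = (\<Sum>i\<in>I. F (g i))"
proof -
  interpret Modules.additive F by unfold_locales (rule assms)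
  show ?thesis by (rule sum)
qed

context novikov_dialgebra
begin

lemma bracket_gen_0:
  "bracket_gen left right 0 b = 0" "bracket_gen left right a 0 = 0"
proof -
  have z: "f 0 = 0" if "Vector_Spaces.linear scale scale f" for f :: "'a \<Rightarrow> 'a"
  proof -
    interpret f: Vector_Spaces.linear scale scale f by (rule that)
    show ?thesis by (rule f.zero)
  qed
  show "bracket_gen left right 0 b = 0" "bracket_gen left right a 0 = 0"
    using z[OF left_linear1] z[OF left_linear2] z[OF right_linear1] z[OF right_linear2]
    by (simp_all add: bracket_gen_def cur_D_def)
qed

lemma bracket_bound:
  assumes "Polynomial.degree p \<le> m" "Polynomial.degree q \<le> n"
  shows "bracket left right p q =
     (\<Sum>i\<le>m. \<Sum>j\<le>n. ((\<lambda>P. - mult_lambda P) ^^ i)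
       (((\<lambda>P. mult_lambda P + mult_D P) ^^ j) (bracket_gen left right (coeff p i) (coeff q j))))"
proof -
  let ?F = "\<lambda>P :: 'a poly poly. - mult_lambda P"
  let ?G = "\<lambda>P :: 'a poly poly. mult_lambda P + mult_D P"
  have F0: "(?F ^^ i) 0 = 0" for i
    by (rule funpow_additive) (simp add: mult_lambda_add)
  have G0: "(?G ^^ i) 0 = 0" for i
    by (rule funpow_additive) (simp add: mult_lambda_add mult_D_add algebra_simps)
  let ?t = "\<lambda>i j. (?F ^^ i) ((?G ^^ j) (bracket_gen left right (coeff p i) (coeff q j)))"
  have "(\<Sum>i\<le>m. \<Sum>j\<le>n. ?t i j) = (\<Sum>i\<le>m. \<Sum>j\<le>Polynomial.degree q. ?t i j)"
    by (intro sum.cong refl sum.mono_neutral_right)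
      (use assms in \<open>auto simp: coeff_eq_0 bracket_gen_0 F0 G0\<close>)
  also have "\<dots> = (\<Sum>i\<le>Polynomial.degree p. \<Sum>j\<le>Polynomial.degree q. ?t i j)"
    by (intro sum.mono_neutral_right)
      (use assms in \<open>auto simp: coeff_eq_0 bracket_gen_0 F0 G0\<close>)
  finally show ?thesis by (simp add: bracket_def)
qed

lemma bracket_sesquilinear1:
  "bracket left right (cur_D p) q = - mult_lambda (bracket left right p q)"
proof -
  let ?F = "\<lambda>P :: 'a poly poly. - mult_lambda P"
  let ?G = "\<lambda>P :: 'a poly poly. mult_lambda P + mult_D P"
  let ?n = "Polynomial.degree q"
  have G0: "(?G ^^ i) 0 = 0" for i
    by (rule funpow_additive) (simp add: mult_lambda_add mult_D_add algebra_simps)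
  have add: "?F (x + y) = ?F x + ?F y" for x y by (simp add: mult_lambda_add)
  have "bracket left right (cur_D p) q = (\<Sum>i\<le>Suc (Polynomial.degree p). \<Sum>j\<le>?n.
      (?F ^^ i) ((?G ^^ j) (bracket_gen left right (coeff (cur_D p) i) (coeff q j))))"
    by (rule bracket_bound) (simp_all add: cur_D_def degree_pCons_le)
  also have "\<dots> = (\<Sum>i\<le>Polynomial.degree p. \<Sum>j\<le>?n.
      ?F ((?F ^^ i) ((?G ^^ j) (bracket_gen left right (coeff p i) (coeff q j)))))"
    by (subst sum.atMost_Suc_shift) (simp add: cur_D_def bracket_gen_0 G0)
  also have "\<dots> = ?F (bracket left right p q)"
    unfolding bracket_def additive_sum[of ?F, OF add] ..
  finally show ?thesis .
qed

lemma bracket_sesquilinear2: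
  "bracket left right p (cur_D q) =
     mult_lambda (bracket left right p q) + mult_D (bracket left right p q)"
proof -
  let ?F = "\<lambda>P :: 'a poly poly. - mult_lambda P"
  let ?G = "\<lambda>P :: 'a poly poly. mult_lambda P + mult_D P"
  let ?m = "Polynomial.degree p"
  have F0: "(?F ^^ i) 0 = 0" for i
    by (rule funpow_additive) (simp add: mult_lambda_add)
  have add: "?G (x + y) = ?G x + ?G y" for x y
    by (simp add: mult_lambda_add mult_D_add algebra_simps)
  have FG: "(?F ^^ i) (?G P) = ?G ((?F ^^ i) P)" for i P
    by (induction i) (simp_all add: mult_lambda_add mult_D_minus mult_D_lambda,
      simp_all add: mult_lambda_def)
  have "bracket left right p (cur_D q) = (\<Sum>i\<le>?m. \<Sum>j\<le>Suc (Polynomial.degree q).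
      (?F ^^ i) ((?G ^^ j) (bracket_gen left right (coeff p i) (coeff (cur_D q) j))))"
    by (rule bracket_bound) (simp_all add: cur_D_def degree_pCons_le)
  also have "\<dots> = (\<Sum>i\<le>?m. \<Sum>j\<le>Polynomial.degree q.
      ?G ((?F ^^ i) ((?G ^^ j) (bracket_gen left right (coeff p i) (coeff q j)))))"
    by (subst sum.atMost_Suc_shift) (simp add: cur_D_def bracket_gen_0 F0 FG)
  also have "\<dots> = ?G (bracket left right p q)"
    unfolding bracket_def additive_sum[of ?G, OF add] ..
  finally show ?thesis .
qed

end

end

theory Submission
  imports Defs
begin

text \<open>
  For constants \<open>a\<close>, \<open>b\<close> the bracket is \<open>[a\<^sub>\<lambda> b] = \<partial>(b \<stileturn> a) + \<lambda>(a \<turnstile> b + b \<stileturn> a)\<close>, so for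
  \<open>r = \<Sum>\<^sub>i a\<^sub>i \<otimes> b\<^sub>i\<close> in \<open>A \<otimes> A\<close> every summand of \<open>[[r,r]]\<close> is a single \<open>\<partial>\<^sub>1\<close>, \<open>\<partial>\<^sub>2\<close> or
  \<open>\<partial>\<^sub>3\<close> applied to an element of \<open>A \<otimes> A \<otimes> A\<close>.  The coefficient of \<open>\<partial>\<^sub>3\<close> is
  \<open>Z = \<Sum> a\<^sub>i \<otimes> a\<^sub>j \<otimes> (b\<^sub>i \<stileturn> b\<^sub>j)\<close>.  Subtracting \<open>(\<partial>\<^sub>1 + \<partial>\<^sub>2 + \<partial>\<^sub>3) Z\<close> leaves
  \<open>\<partial>\<^sub>1 X\<^sub>1 + \<partial>\<^sub>2 X\<^sub>2\<close>, where

  \<open>X\<^sub>2 = \<Sum> (a\<^sub>i \<turnstile> a\<^sub>j + a\<^sub>j \<stileturn> a\<^sub>i) \<otimes> b\<^sub>i \<otimes> b\<^sub>j + a\<^sub>i \<otimes> (a\<^sub>j \<turnstile> b\<^sub>i - a\<^sub>j \<stileturn> b\<^sub>i) \<otimes> b\<^sub>j + a\<^sub>i \<otimes> a\<^sub>j \<otimes> (b\<^sub>j \<turnstile> b\<^sub>i)\<close>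

  and \<open>X\<^sub>1 = X\<^sub>2 - N(r)\<close> holds summand by summand.  If \<open>r\<close> is symmetric, the legs of both
  copies of \<open>r\<close> may be exchanged; doing this and exchanging the two copies turns \<open>X\<^sub>2\<close> into
  \<open>\<sigma> N(r)\<close>, where \<open>\<sigma>\<close> reverses the order of the three tensor factors.  Therefore

  \<open>[[r,r]] = \<partial>\<^sub>1 (\<sigma> N(r) - N(r)) + \<partial>\<^sub>2 (\<sigma> N(r))\<close> modulo total derivatives.

  If \<open>N(r) = 0\<close>, then \<open>[[r,r]]\<close> is a total derivative.  For the converse, the triple tensor
  power of \<open>k[\<partial>] \<otimes> A\<close> modulo total derivatives is \<open>(A \<otimes> A \<otimes> A)[\<partial>\<^sub>1, \<partial>\<^sub>2]\<close>, and reading off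
  the coefficient of \<open>\<partial>\<^sub>2\<close> recovers \<open>\<sigma> N(r)\<close>.

  Tensors are cosets of formal sums.  Instead of calculating with cosets, the proof tests them
  with multilinear forms: two formal sums are congruent if and only if every multilinear form
  takes the same value on both (\<open>cong2_iff\<close>, \<open>cong3_iff\<close>).  Each identity above thereby becomes
  an equation between scalars.  The displayed congruence is
  \<open>eval3_clc_modulo_total_derivative\<close>, and the symmetry of \<open>r\<close> enters through
  \<open>double_sum_flip\<close>.
\<close>


section \<open>Linear functionals on formal sums\<close>

definition form_ext :: "('x \<Rightarrow> 'k) \<Rightarrow> ('x \<Rightarrow>\<^sub>0 'k::field) \<Rightarrow> 'k" where
  "form_ext g x = (\<Sum>p\<in>Poly_Mapping.keys x. Poly_Mapping.lookup x p * g p)"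

lemma lookup_fscale [simp]:
  "Poly_Mapping.lookup (fscale c x) p = c * Poly_Mapping.lookup x p"
  by (simp add: fscale_def Poly_Mapping.map.rep_eq when_def)

lemma form_ext_superset:
  assumes "finite S" "Poly_Mapping.keys x \<subseteq> S"
  shows "form_ext g x = (\<Sum>p\<in>S. Poly_Mapping.lookup x p * g p)"
  unfolding form_ext_def
  by (rule sum.mono_neutral_left) (use assms in \<open>auto simp: in_keys_iff\<close>)

lemma form_ext_add [simp]: "form_ext g (x + y) = form_ext g x + form_ext g y"
proof -
  let ?S = "Poly_Mapping.keys x \<union> Poly_Mapping.keys y"
  have "Poly_Mapping.keys (x + y) \<subseteq> ?S"
    by (rule Poly_Mapping.keys_add)
  then show ?thesis
    by (simp add: form_ext_superset[of ?S] lookup_add algebra_simps sum.distrib)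
qed

lemma form_ext_fscale [simp]: "form_ext g (fscale c x) = c * form_ext g x"
proof -
  have "Poly_Mapping.keys (fscale c x) \<subseteq> Poly_Mapping.keys x"
    by (auto simp: in_keys_iff)
  then show ?thesis
    by (simp add: form_ext_superset[of "Poly_Mapping.keys x"] sum_distrib_left algebra_simps)
qed

lemma form_ext_0 [simp]: "form_ext g 0 = 0"
  by (simp add: form_ext_def)

lemma form_ext_uminus [simp]: "form_ext g (- x) = - form_ext g x"
  using form_ext_add[of g x "- x"] by (simp add: eq_neg_iff_add_eq_0 add.commute)

lemma form_ext_diff [simp]: "form_ext g (x - y) = form_ext g x - form_ext g y"
  using form_ext_add[of g x "- y"] by simp

lemma form_ext_sum [simp]: "form_ext g (sum f S) = (\<Sum>i\<in>S. form_ext g (f i))"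
  by (rule additive_sum) simp

lemma form_ext_single [simp]: "form_ext g (Poly_Mapping.single p c) = c * g p"
  by (simp add: form_ext_def)

lemma form_ext_lin_ext [simp]: "form_ext g (lin_ext f x) = form_ext (\<lambda>p. form_ext g (f p)) x"
  by (simp add: lin_ext_def form_ext_def[of _ x])

lemma form_ext_quad_ext [simp]:
  "form_ext g (quad_ext f x) = form_ext (\<lambda>p. form_ext (\<lambda>q. form_ext g (f p q)) x) x"
  by (simp add: quad_ext_def form_ext_def[of _ x] sum_distrib_left mult.assoc)

lemma form_ext_fun_add: "form_ext (\<lambda>p. g p + h p) x = form_ext g x + form_ext h x"
  by (simp add: form_ext_def sum.distrib algebra_simps)

lemma form_ext_fun_diff: "form_ext (\<lambda>p. g p - h p) x = form_ext g x - form_ext h x"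
  by (simp add: form_ext_def sum_subtractf algebra_simps)

lemma form_ext_fun_uminus: "form_ext (\<lambda>p. - g p) x = - form_ext g x"
  by (simp add: form_ext_def sum_negf)

lemma form_ext_commute:
  "form_ext (\<lambda>p. form_ext (\<lambda>q. G p q) y) x = form_ext (\<lambda>q. form_ext (\<lambda>p. G p q) x) y"
  unfolding form_ext_def sum_distrib_left
  by (subst sum.swap) (simp add: algebra_simps)

interpretation formal: vector_space "fscale :: 'k::field \<Rightarrow> ('x \<Rightarrow>\<^sub>0 'k) \<Rightarrow> _"
  by (rule vector_space_fscale)

lemma formal_sum_singles:
  "x = (\<Sum>p\<in>Poly_Mapping.keys x. fscale (Poly_Mapping.lookup x p) (Poly_Mapping.single p 1))"
  for x :: "'x \<Rightarrow>\<^sub>0 'k::field"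
  by (rule poly_mapping_eqI)
    (simp add: lookup_sum lookup_single when_def if_distrib sum.delta' in_keys_iff cong: if_cong)

text \<open>
  A vector outside a subspace is separated from it by a functional: extend a basis of the
  subspace by the vector and prescribe the values 0 and 1.  A functional on formal sums is
  determined by its values on the generators, hence is of the form \<open>form_ext g\<close>.
\<close>

lemma in_span_iff_form_ext:
  fixes x :: "'x \<Rightarrow>\<^sub>0 'k::field"
  shows "x \<in> formal.span S \<longleftrightarrow> (\<forall>g. (\<forall>s\<in>S. form_ext g s = 0) \<longrightarrow> form_ext g x = 0)"
proof
  assume "x \<in> formal.span S"
  then show "\<forall>g. (\<forall>s\<in>S. form_ext g s = 0) \<longrightarrow> form_ext g x = 0"
    by (induction rule: formal.span_induct_alt) auto
next
  assume *: "\<forall>g. (\<forall>s\<in>S. form_ext g s = 0) \<longrightarrow> form_ext g x = 0"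
  interpret pair: vector_space_pair "fscale :: 'k \<Rightarrow> ('x \<Rightarrow>\<^sub>0 'k) \<Rightarrow> _" "(*) :: 'k \<Rightarrow> 'k \<Rightarrow> 'k"
    by unfold_locales (auto simp: algebra_simps)
  show "x \<in> formal.span S"
  proof (rule ccontr)
    assume x: "x \<notin> formal.span S"
    obtain B where B: "B \<subseteq> S" "formal.independent B" "S \<subseteq> formal.span B"
      using formal.maximal_independent_subset by blast
    then have "formal.span B = formal.span S"
      by (metis formal.span_mono formal.span_span subset_antisym)
    with x B have "formal.independent (insert x B)"
      using formal.independent_insertI by metis
    then obtain L where L: "Vector_Spaces.linear fscale (*) L"
      and L_eq: "\<forall>y\<in>insert x B. L y = (if y = x then 1 else 0)"
      using pair.linear_independent_extend[of "insert x B" "\<lambda>y. if y = x then 1 else 0"] by blast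
    interpret L: Vector_Spaces.linear fscale "(*)" L by (rule L)
    let ?g = "\<lambda>p. L (Poly_Mapping.single p 1)"
    have L_ext: "L y = form_ext ?g y" for y
      by (subst formal_sum_singles[of y]) (simp add: L.sum L.scale form_ext_def)
    have LB: "L y = 0" if "y \<in> B" for y
      using that x L_eq \<open>formal.span B = formal.span S\<close> formal.span_base by auto
    have "L y = 0" if "y \<in> formal.span B" for y
      using that by (induction rule: formal.span_induct_alt) (auto simp: L.add L.scale LB L.zero)
    then have "\<forall>s\<in>S. form_ext ?g s = 0"
      using B(3) by (auto simp flip: L_ext)
    with * have "L x = 0" using L_ext[of x] by metis
    with L_eq show False by simp
  qed
qed


section \<open>Multilinear forms detect equality of tensors\<close>

definition linear_form :: "('k::field \<Rightarrow> 'v::ab_group_add \<Rightarrow> 'v) \<Rightarrow> ('v \<Rightarrow> 'k) \<Rightarrow> bool" where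
  "linear_form scale f \<longleftrightarrow> (\<forall>a b. f (a + b) = f a + f b) \<and> (\<forall>t a. f (scale t a) = t * f a)"

definition bilinear_form ::
    "('k::field \<Rightarrow> 'v::ab_group_add \<Rightarrow> 'v) \<Rightarrow> ('v \<Rightarrow> 'v \<Rightarrow> 'k) \<Rightarrow> bool" where
  "bilinear_form scale B \<longleftrightarrow>
     (\<forall>b. linear_form scale (\<lambda>a. B a b)) \<and> (\<forall>a. linear_form scale (\<lambda>b. B a b))"

definition trilinear_form ::
    "('k::field \<Rightarrow> 'v::ab_group_add \<Rightarrow> 'v) \<Rightarrow> ('v \<Rightarrow> 'v \<Rightarrow> 'v \<Rightarrow> 'k) \<Rightarrow> bool" where
  "trilinear_form scale T \<longleftrightarrow>
     (\<forall>b c. linear_form scale (\<lambda>a. T a b c)) \<and>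
     (\<forall>a c. linear_form scale (\<lambda>b. T a b c)) \<and>
     (\<forall>a b. linear_form scale (\<lambda>c. T a b c))"

abbreviation eval2 :: "('v \<Rightarrow> 'v \<Rightarrow> 'k) \<Rightarrow> ('v \<times> 'v \<Rightarrow>\<^sub>0 'k::field) \<Rightarrow> 'k" where
  "eval2 B \<equiv> form_ext (\<lambda>(a, b). B a b)"

abbreviation eval3 :: "('v \<Rightarrow> 'v \<Rightarrow> 'v \<Rightarrow> 'k) \<Rightarrow> ('v \<times> 'v \<times> 'v \<Rightarrow>\<^sub>0 'k::field) \<Rightarrow> 'k" where
  "eval3 T \<equiv> form_ext (\<lambda>(a, b, c). T a b c)"

lemma form_ext_e2 [simp]: "form_ext g (e2 a b) = g (a, b)"
  by (simp add: e2_def)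

lemma form_ext_e3 [simp]: "form_ext g (e3 a b c) = g (a, b, c)"
  by (simp add: e3_def)

lemma linear_form_zero: "linear_form scale f \<Longrightarrow> f 0 = 0"
  unfolding linear_form_def by (metis add_cancel_right_right)

lemma trilinear_form_zero:
  assumes "trilinear_form scale T"
  shows "T 0 b c = 0" "T a 0 c = 0" "T a b 0 = 0"
  using assms
    linear_form_zero[of scale "\<lambda>a. T a b c"] linear_form_zero[of scale "\<lambda>b. T a b c"]
    linear_form_zero[of scale "\<lambda>c. T a b c"]
  by (auto simp: trilinear_form_def)

text \<open>
  A functional vanishes on the multilinearity relations exactly if its values on the generators
  form a bilinear map, so the separation lemma turns congruence into a test by bilinear forms.
\<close>

lemma cong2_iff:
  "(x, y) \<in> cong2 scale \<longleftrightarrow> (\<forall>B. bilinear_form scale B \<longrightarrow> eval2 B x = eval2 B y)"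
proof -
  let ?S = "{e2 (a + a') b - e2 a b - e2 a' b | a a' b. True} \<union>
      {e2 a (b + b') - e2 a b - e2 a b' | a b b'. True} \<union>
      {e2 (scale t a) b - fscale t (e2 a b) | t a b. True} \<union>
      {e2 a (scale t b) - fscale t (e2 a b) | t a b. True}"
  have "(\<forall>s\<in>?S. Q s) \<longleftrightarrow>
      (\<forall>a a' b. Q (e2 (a + a') b - e2 a b - e2 a' b)) \<and>
      (\<forall>a b b'. Q (e2 a (b + b') - e2 a b - e2 a b')) \<and>
      (\<forall>t a b. Q (e2 (scale t a) b - fscale t (e2 a b))) \<and>
      (\<forall>t a b. Q (e2 a (scale t b) - fscale t (e2 a b)))" for Q
    unfolding ball_Un conj_assoc by (intro conj_cong; blast)
  from this[of "\<lambda>s. form_ext g s = 0" for g]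
  have gen: "(\<forall>s\<in>?S. form_ext g s = 0) \<longleftrightarrow> bilinear_form scale (curry g)" for g
    unfolding bilinear_form_def linear_form_def by (simp add: diff_diff_eq) blast
  have "(\<forall>g. bilinear_form scale (curry g) \<longrightarrow> form_ext g z = 0) \<longleftrightarrow>
      (\<forall>B. bilinear_form scale B \<longrightarrow> eval2 B z = 0)" for z
    by (metis case_prod_curry curry_case_prod)
  from this[of "x - y"] show ?thesis
    unfolding cong2_def null2_def mem_Collect_eq case_prod_conv in_span_iff_form_ext gen by simp
qed

lemma cong3_iff:
  "(x, y) \<in> cong3 scale \<longleftrightarrow> (\<forall>T. trilinear_form scale T \<longrightarrow> eval3 T x = eval3 T y)"
proof -
  let ?S = "{e3 (a + a') b c - e3 a b c - e3 a' b c | a a' b c. True} \<union>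
      {e3 a (b + b') c - e3 a b c - e3 a b' c | a b b' c. True} \<union>
      {e3 a b (c + c') - e3 a b c - e3 a b c' | a b c c'. True} \<union>
      {e3 (scale t a) b c - fscale t (e3 a b c) | t a b c. True} \<union>
      {e3 a (scale t b) c - fscale t (e3 a b c) | t a b c. True} \<union>
      {e3 a b (scale t c) - fscale t (e3 a b c) | t a b c. True}"
  have "(\<forall>s\<in>?S. Q s) \<longleftrightarrow>
      (\<forall>a a' b c. Q (e3 (a + a') b c - e3 a b c - e3 a' b c)) \<and>
      (\<forall>a b b' c. Q (e3 a (b + b') c - e3 a b c - e3 a b' c)) \<and>
      (\<forall>a b c c'. Q (e3 a b (c + c') - e3 a b c - e3 a b c')) \<and>
      (\<forall>t a b c. Q (e3 (scale t a) b c - fscale t (e3 a b c))) \<and>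
      (\<forall>t a b c. Q (e3 a (scale t b) c - fscale t (e3 a b c))) \<and>
      (\<forall>t a b c. Q (e3 a b (scale t c) - fscale t (e3 a b c)))" for Q
    unfolding ball_Un conj_assoc by (intro conj_cong; blast)
  from this[of "\<lambda>s. form_ext g s = 0" for g]
  have gen: "(\<forall>s\<in>?S. form_ext g s = 0) \<longleftrightarrow> trilinear_form scale (\<lambda>a b c. g (a, b, c))" for g
    unfolding trilinear_form_def linear_form_def
    by (simp add: diff_diff_eq) (intro iffI conjI allI; simp)
  have "(x, y) \<in> cong3 scale \<longleftrightarrow>
      (\<forall>g. trilinear_form scale (\<lambda>a b c. g (a, b, c)) \<longrightarrow> form_ext g x = form_ext g y)"
    unfolding cong3_def null3_def mem_Collect_eq case_prod_conv in_span_iff_form_ext gen by simp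
  also have "\<dots> \<longleftrightarrow> (\<forall>T. trilinear_form scale T \<longrightarrow> eval3 T x = eval3 T y)"
  proof (intro iffI allI impI)
    fix T assume "\<forall>g. trilinear_form scale (\<lambda>a b c. g (a, b, c)) \<longrightarrow> form_ext g x = form_ext g y"
      and "trilinear_form scale T"
    then show "eval3 T x = eval3 T y"
      by (drule_tac spec[of _ "\<lambda>(a, b, c). T a b c"]) simp
  next
    fix g assume "\<forall>T. trilinear_form scale T \<longrightarrow> eval3 T x = eval3 T y"
      and "trilinear_form scale (\<lambda>a b c. g (a, b, c))"
    then show "form_ext g x = form_ext g y"
      by (drule_tac spec[of _ "\<lambda>a b c. g (a, b, c)"]) simp
  qed
  finally show ?thesis .
qed

lemma bilinear_formI:
  assumes "\<And>a a' b. B (a + a') b = B a b + B a' b" "\<And>a b b'. B a (b + b') = B a b + B a b'"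
    and "\<And>t a b. B (scale t a) b = t * B a b" "\<And>t a b. B a (scale t b) = t * B a b"
  shows "bilinear_form scale B"
  using assms by (simp add: bilinear_form_def linear_form_def)

lemma trilinear_formI:
  assumes "\<And>a a' b c. T (a + a') b c = T a b c + T a' b c"
    and "\<And>a b b' c. T a (b + b') c = T a b c + T a b' c"
    and "\<And>a b c c'. T a b (c + c') = T a b c + T a b c'"
    and "\<And>t a b c. T (scale t a) b c = t * T a b c"
    and "\<And>t a b c. T a (scale t b) c = t * T a b c"
    and "\<And>t a b c. T a b (scale t c) = t * T a b c"
  shows "trilinear_form scale T"
  using assms by (simp add: trilinear_form_def linear_form_def)

lemma trilinear_form_add:
  assumes "trilinear_form scale T"
  shows "T (a + a') b c = T a b c + T a' b c"
    and "T a (b + b') c = T a b c + T a b' c"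
    and "T a b (c + c') = T a b c + T a b c'"
  using assms by (simp_all add: trilinear_form_def linear_form_def)

lemma trilinear_form_scale:
  assumes "trilinear_form scale T"
  shows "T (scale t a) b c = t * T a b c"
    and "T a (scale t b) c = t * T a b c"
    and "T a b (scale t c) = t * T a b c"
  using assms by (simp_all add: trilinear_form_def linear_form_def)

lemma trilinear_form_diff:
  assumes "trilinear_form scale T"
  shows "T (a - a') b c = T a b c - T a' b c"
    and "T a (b - b') c = T a b c - T a b' c"
    and "T a b (c - c') = T a b c - T a b c'"
  using trilinear_form_add(1)[OF assms, of "a - a'" a' b c]
  apply (simp add: eq_diff_eq)
  using trilinear_form_add(2)[OF assms, of a "b - b'" b' c]
  apply (simp add: eq_diff_eq)
  using trilinear_form_add(3)[OF assms, of a b "c - c'" c']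
  by (simp add: eq_diff_eq)

lemmas trilinear_form_simps = trilinear_form_add trilinear_form_scale trilinear_form_diff

lemma trilinear_form_reverse:
  "trilinear_form scale T \<Longrightarrow> trilinear_form scale (\<lambda>a b c. T c b a)"
  by (simp add: trilinear_form_def)

lemma equiv_cong2: "equiv UNIV (cong2 scale)"
  by (auto simp: equiv_def refl_on_def sym_def trans_def cong2_iff)

lemma equiv_cong3: "equiv UNIV (cong3 scale)"
  by (auto simp: equiv_def refl_on_def sym_def trans_def cong3_iff)

text \<open>
  Evaluates an induced map on a representative.  The union in the definition of \<open>quot_lift\<close> ranges
  over all representatives, so this is where well-definedness on tensors has to be supplied.
\<close>

lemma quot_lift_class:
  assumes "equiv UNIV S" "equiv UNIV R" "\<And>y. (x, y) \<in> S \<Longrightarrow> (f x, f y) \<in> R"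
  shows "quot_lift R f (S `` {x}) = R `` {f x}"
proof -
  have "R `` {f y} = R `` {f x}" if "y \<in> S `` {x}" for y
    using assms(3)[of y] that equiv_class_eq[OF assms(2)] by blast
  moreover have "x \<in> S `` {x}"
    using equiv_class_self[OF assms(1)] by blast
  ultimately show ?thesis
    unfolding quot_lift_def by blast
qed

lemma form_ext_cong2:
  assumes "(x, y) \<in> cong2 scale" "bilinear_form scale (\<lambda>a b. g (a, b))"
  shows "form_ext g x = form_ext g y"
proof -
  have "eval2 (\<lambda>a b. g (a, b)) x = eval2 (\<lambda>a b. g (a, b)) y"
    using assms unfolding cong2_iff by blast
  then show ?thesis by simp
qed

text \<open>
  Well-definedness of a quadratic expression on tensors: since its polarization is bilinear in
  each of the two copies of the argument, the copies can be replaced one after the other.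
\<close>

lemma quad_ext_cong:
  assumes "(x, y) \<in> cong2 scale"
    and "\<And>T q. trilinear_form scale T \<Longrightarrow> bilinear_form scale (\<lambda>a b. eval3 T (f (a, b) q))"
    and "\<And>T p. trilinear_form scale T \<Longrightarrow> bilinear_form scale (\<lambda>a b. eval3 T (f p (a, b)))"
  shows "(quad_ext f x, quad_ext f y) \<in> cong3 scale"
  unfolding cong3_iff
proof (intro allI impI)
  fix T assume T: "trilinear_form scale T"
  have "form_ext (\<lambda>p. form_ext (\<lambda>q. eval3 T (f p q)) x) x =
      form_ext (\<lambda>p. form_ext (\<lambda>q. eval3 T (f p q)) y) x"
    using form_ext_cong2[OF assms(1) assms(3)[OF T]] by simp
  also have "\<dots> = form_ext (\<lambda>q. form_ext (\<lambda>p. eval3 T (f p q)) x) y"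
    by (rule form_ext_commute)
  also have "\<dots> = form_ext (\<lambda>q. form_ext (\<lambda>p. eval3 T (f p q)) y) y"
    using form_ext_cong2[OF assms(1) assms(2)[OF T]] by simp
  also have "\<dots> = form_ext (\<lambda>p. form_ext (\<lambda>q. eval3 T (f p q)) y) y"
    by (rule form_ext_commute)
  finally show "eval3 T (quad_ext f x) = eval3 T (quad_ext f y)"
    by simp
qed

text \<open>
  For a symmetric tensor \<open>\<Sum>\<^sub>i a\<^sub>i \<otimes> b\<^sub>i\<close> the legs of both copies may be exchanged; the copies
  themselves can always be exchanged.  The combination of the three exchanges reverses the
  order of \<open>a\<^sub>i, b\<^sub>i, a\<^sub>j, b\<^sub>j\<close>, which is what reversing the tensor factors of \<open>N(r)\<close> requires.
\<close>

lemma double_sum_flip: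
  assumes r_sym: "(lin_ext (\<lambda>(a, b). e2 b a) x, x) \<in> cong2 scale"
    and bilinear: "\<And>u v. bilinear_form scale (\<lambda>a b. F a b u v)"
      "\<And>a b. bilinear_form scale (\<lambda>u v. F a b u v)"
  shows "eval2 (\<lambda>a b. eval2 (\<lambda>a' b'. F a b a' b') x) x =
    eval2 (\<lambda>a b. eval2 (\<lambda>a' b'. F b' a' b a) x) x"
proof -
  have flip: "eval2 B x = eval2 (\<lambda>a b. B b a) x" if "bilinear_form scale B" for B
    using r_sym that by (simp add: cong2_iff case_prod_unfold)
  have "eval2 (\<lambda>a b. eval2 (\<lambda>a' b'. F a b a' b') x) x =
      eval2 (\<lambda>a b. eval2 (\<lambda>a' b'. F a b b' a') x) x"
    by (subst flip[OF bilinear(2)]) (rule refl)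
  also have "\<dots> = eval2 (\<lambda>a' b'. eval2 (\<lambda>a b. F a b b' a') x) x"
    unfolding case_prod_unfold by (rule form_ext_commute)
  also have "\<dots> = eval2 (\<lambda>a' b'. eval2 (\<lambda>a b. F b a b' a') x) x"
    by (subst flip[OF bilinear(1)]) (rule refl)
  finally show ?thesis .
qed


section \<open>Forms and substitution of operators\<close>

text \<open>
  \<open>S\<close> pulls multilinear forms back to multilinear forms, which is the form that
  well-definedness and linearity of \<open>S\<close> on the triple tensor power take when tensors are tested
  by forms.
\<close>

definition has_transpose ::
    "('k::field \<Rightarrow> 'v::ab_group_add \<Rightarrow> 'v) \<Rightarrow>
     (('v \<times> 'v \<times> 'v \<Rightarrow>\<^sub>0 'k) \<Rightarrow> ('v \<times> 'v \<times> 'v \<Rightarrow>\<^sub>0 'k)) \<Rightarrow> bool" where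
  "has_transpose scale S \<longleftrightarrow>
     (\<forall>T. trilinear_form scale T \<longrightarrow>
       (\<exists>T'. trilinear_form scale T' \<and> (\<forall>x. eval3 T (S x) = eval3 T' x)))"

lemma has_transpose_funpow:
  assumes "has_transpose scale S"
  shows "has_transpose scale (S ^^ k)"
proof (induction k)
  case 0
  show ?case by (auto simp: has_transpose_def)
next
  case (Suc k)
  with assms show ?case
    unfolding has_transpose_def by (simp, metis)
qed

lemma eval3_derivations [simp]:
  "form_ext g (d1 D x) = eval3 (\<lambda>a b c. g (D a, b, c)) x"
  "form_ext g (d2 D x) = eval3 (\<lambda>a b c. g (a, D b, c)) x"
  "form_ext g (d3 D x) = eval3 (\<lambda>a b c. g (a, b, D c)) x"
  by (simp_all add: d1_def d2_def d3_def case_prod_unfold)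

lemma has_transpose_derivations:
  assumes "\<And>a b. D (a + b) = D a + D b" "\<And>t a. D (scale t a) = scale t (D a)"
  shows "has_transpose scale (d1 D)" "has_transpose scale (d2 D)"
    "has_transpose scale (\<lambda>x. - d1 D x - d2 D x)"
    "has_transpose scale (\<lambda>x. d1 D x + d2 D x + d3 D x)"
proof -
  show "has_transpose scale (d1 D)"
    unfolding has_transpose_def
    by (intro allI impI, rule_tac x = "\<lambda>a b c. T (D a) b c" in exI)
      (auto intro!: trilinear_formI simp: trilinear_form_simps assms)
  show "has_transpose scale (d2 D)"
    unfolding has_transpose_def
    by (intro allI impI, rule_tac x = "\<lambda>a b c. T a (D b) c" in exI)
      (auto intro!: trilinear_formI simp: trilinear_form_simps assms)
  show "has_transpose scale (\<lambda>x. - d1 D x - d2 D x)"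
    unfolding has_transpose_def
    by (intro allI impI, rule_tac x = "\<lambda>a b c. - T (D a) b c - T a (D b) c" in exI)
      (auto intro!: trilinear_formI simp: trilinear_form_simps assms algebra_simps case_prod_unfold
          form_ext_fun_diff form_ext_fun_uminus)
  show "has_transpose scale (\<lambda>x. d1 D x + d2 D x + d3 D x)"
    unfolding has_transpose_def
    by (intro allI impI, rule_tac x = "\<lambda>a b c. T (D a) b c + T a (D b) c + T a b (D c)" in exI)
      (auto intro!: trilinear_formI simp: trilinear_form_simps assms algebra_simps case_prod_unfold
          form_ext_fun_add)
qed

lemma has_transpose_cong3:
  assumes "has_transpose scale S" "(x, y) \<in> cong3 scale"
  shows "(S x, S y) \<in> cong3 scale"
  using assms unfolding has_transpose_def cong3_iff by metis


text \<open>
  The polynomial coefficient is placed into different tensor factors in the terms of \<open>[[r,r]]\<close>;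
  this property is shared by all placements of the first argument.
\<close>

definition trilinear_insertion ::
    "('k::field \<Rightarrow> 'v::ab_group_add \<Rightarrow> 'v) \<Rightarrow> ('v \<Rightarrow> 'v \<Rightarrow> 'v \<Rightarrow> ('v \<times> 'v \<times> 'v \<Rightarrow>\<^sub>0 'k)) \<Rightarrow> bool" where
  "trilinear_insertion scale ins \<longleftrightarrow>
     (\<forall>T. trilinear_form scale T \<longrightarrow> trilinear_form scale (\<lambda>a b c. eval3 T (ins a b c)))"

lemma trilinear_insertion_e3:
  "trilinear_insertion scale e3"
  "trilinear_insertion scale (\<lambda>a b c. e3 b a c)"
  "trilinear_insertion scale (\<lambda>a b c. e3 b c a)"
  by (simp_all add: trilinear_insertion_def trilinear_form_def)

lemma trilinear_form_subst_power:
  assumes "has_transpose scale S" "trilinear_form scale T" "trilinear_insertion scale ins"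
  shows "trilinear_form scale (\<lambda>a b c. eval3 T ((S ^^ k) (ins a b c)))"
proof -
  obtain T' where "trilinear_form scale T'" "\<And>x. eval3 T ((S ^^ k) x) = eval3 T' x"
    using has_transpose_funpow[OF assms(1), of k] assms(2) unfolding has_transpose_def by blast
  with assms(3) show ?thesis by (simp add: trilinear_insertion_def)
qed

text \<open>
  Replaces the degree of the polynomial by an arbitrary bound, so that polynomials of
  different degrees can be added.
\<close>

lemma eval3_subst_op:
  assumes "has_transpose scale S" "trilinear_form scale T" "trilinear_insertion scale ins"
    and "Polynomial.degree P \<le> n"
  shows "eval3 T (subst_op S P (\<lambda>u. ins u b c)) =
    (\<Sum>k\<le>n. eval3 T ((S ^^ k) (ins (coeff P k) b c)))"
  unfolding subst_op_def form_ext_sum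
  by (rule sum.mono_neutral_left)
    (use assms(4) trilinear_form_zero(1)[OF trilinear_form_subst_power[OF assms(1-3)]]
      in \<open>auto simp: coeff_eq_0\<close>)

lemma coeff_cur_scale:
  "scale t 0 = 0 \<Longrightarrow> coeff (cur_scale scale t p) k = scale t (coeff p k)"
  by (simp add: cur_scale_def coeff_map_poly)

lemma degree_cur_scale_le:
  "scale t 0 = 0 \<Longrightarrow> Polynomial.degree (cur_scale scale t p) \<le> Polynomial.degree p"
  by (rule degree_le) (simp add: coeff_cur_scale coeff_eq_0)

text \<open>
  Linearity in the polynomial and in the two remaining tensor factors makes the terms of \<open>[[r,r]]\<close>
  well defined on tensors.
\<close>

lemma eval3_subst_op_linear:
  assumes "has_transpose scale S" "trilinear_form scale T" "trilinear_insertion scale ins"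
    and "\<And>t. scale t 0 = 0"
  defines "G \<equiv> \<lambda>P b c. eval3 T (subst_op S P (\<lambda>u. ins u b c))"
  shows "G (P + P') b c = G P b c + G P' b c"
    and "G P (b + b') c = G P b c + G P b' c"
    and "G P b (c + c') = G P b c + G P b c'"
    and "G (cur_scale scale t P) b c = t * G P b c"
    and "G P (scale t b) c = t * G P b c"
    and "G P b (scale t c) = t * G P b c"
proof -
  have G: "G P b c = (\<Sum>k\<le>n. eval3 T ((S ^^ k) (ins (coeff P k) b c)))"
    if "Polynomial.degree P \<le> n" for P b c n
    unfolding G_def by (rule eval3_subst_op[OF assms(1-3) that])
  note tri = trilinear_form_subst_power[OF assms(1-3)]
  note add = trilinear_form_add[OF tri] and scale = trilinear_form_scale[OF tri]
  let ?n = "max (Polynomial.degree P) (Polynomial.degree P')"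
  have "Polynomial.degree (P + P') \<le> ?n" by (rule degree_add_le_max)
  then show "G (P + P') b c = G P b c + G P' b c"
    by (simp add: G[of _ ?n] add sum.distrib)
  show "G P (b + b') c = G P b c + G P b' c" "G P b (c + c') = G P b c + G P b c'"
    by (simp_all add: G[OF order.refl] add sum.distrib)
  show "G (cur_scale scale t P) b c = t * G P b c"
    by (simp add: G[OF degree_cur_scale_le[of scale, OF assms(4)]] G[OF order.refl, of P] coeff_cur_scale assms(4)
        scale sum_distrib_left)
  show "G P (scale t b) c = t * G P b c" "G P b (scale t c) = t * G P b c"
    by (simp_all add: G[OF order.refl] scale sum_distrib_left)
qed


section \<open>Bilinearity of the lambda-bracket\<close>

lemma funpow_add_hom:
  fixes F :: "'b::plus \<Rightarrow> 'b"
  assumes "\<And>x y. F (x + y) = F x + F y"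
  shows "(F ^^ n) (x + y) = (F ^^ n) x + (F ^^ n) y"
  by (induction n) (simp_all add: assms)

lemma funpow_commute_hom:
  fixes F :: "'b \<Rightarrow> 'b"
  assumes "\<And>x. F (h x) = h (F x)"
  shows "(F ^^ n) (h x) = h ((F ^^ n) x)"
  by (induction n) (simp_all add: assms)

context novikov_dialgebra
begin

lemma product_linear:
  "left (a + a') b = left a b + left a' b" "left a (b + b') = left a b + left a b'"
  "right (a + a') b = right a b + right a' b" "right a (b + b') = right a b + right a b'"
  "left (scale t a) b = scale t (left a b)" "left a (scale t b) = scale t (left a b)"
  "right (scale t a) b = scale t (right a b)" "right a (scale t b) = scale t (right a b)"
  using left_linear1 left_linear2 right_linear1 right_linear2
  by (simp_all add: Vector_Spaces.linear_iff)

lemma coeff_poly_scale [simp]: "coeff (cur_scale scale t p) k = scale t (coeff p k)"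
  by (simp add: coeff_cur_scale)

lemma coeff_poly_poly_scale [simp]:
  "coeff (cur_scale (cur_scale scale) t P) k = cur_scale scale t (coeff P k)"
  by (simp add: coeff_cur_scale poly_eq_iff)

lemma cur_D_add: "cur_D (p + q) = cur_D p + cur_D q"
  by (simp add: cur_D_def)

lemma cur_D_scale: "cur_D (cur_scale scale t p) = cur_scale scale t (cur_D p)"
  by (simp add: poly_eq_iff cur_D_def coeff_pCons split: nat.split)

lemma cur_scale_zero [simp]: "cur_scale scale t 0 = 0"
  by (simp add: poly_eq_iff)

lemma bracket_gen_linear:
  "bracket_gen left right (a + a') b = bracket_gen left right a b + bracket_gen left right a' b"
  "bracket_gen left right a (b + b') = bracket_gen left right a b + bracket_gen left right a b'"
  "bracket_gen left right (scale t a) b =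
     cur_scale (cur_scale scale) t (bracket_gen left right a b)"
  "bracket_gen left right a (scale t b) =
     cur_scale (cur_scale scale) t (bracket_gen left right a b)"
  by (auto simp: poly_eq_iff bracket_gen_def product_linear cur_D_def coeff_pCons scale_right_distrib
      split: nat.split)

lemma mult_lambda_scale:
  "mult_lambda (cur_scale (cur_scale scale) t P) = cur_scale (cur_scale scale) t (mult_lambda P)"
  by (simp add: poly_eq_iff mult_lambda_def coeff_pCons split: nat.split)

lemma mult_D_scale:
  "mult_D (cur_scale (cur_scale scale) t P) = cur_scale (cur_scale scale) t (mult_D P)"
  by (intro poly_eqI) (simp add: mult_D_def coeff_map_poly cur_D_scale cur_D_def coeff_pCons
      split: nat.split)

lemma poly_poly_scale_add:
  "cur_scale (cur_scale scale) t (P + Q) =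
     cur_scale (cur_scale scale) t P + cur_scale (cur_scale scale) t Q"
  by (simp add: poly_eq_iff scale_right_distrib)

lemma poly_poly_scale_minus:
  "cur_scale (cur_scale scale) t (- P) = - cur_scale (cur_scale scale) t P"
  by (simp add: poly_eq_iff)

lemma bracket_linear:
  "bracket left right (p + p') q = bracket left right p q + bracket left right p' q"
  "bracket left right p (q + q') = bracket left right p q + bracket left right p q'"
  "bracket left right (cur_scale scale t p) q = cur_scale (cur_scale scale) t (bracket left right p q)"
  "bracket left right p (cur_scale scale t q) = cur_scale (cur_scale scale) t (bracket left right p q)"
proof -
  let ?F = "\<lambda>P :: 'a poly poly. - mult_lambda P"
  let ?G = "\<lambda>P :: 'a poly poly. mult_lambda P + mult_D P"
  let ?h = "cur_scale (cur_scale scale) t"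
  have F: "(?F ^^ i) (x + y) = (?F ^^ i) x + (?F ^^ i) y" for i x y
    by (rule funpow_add_hom) (simp add: mult_lambda_add)
  have G: "(?G ^^ i) (x + y) = (?G ^^ i) x + (?G ^^ i) y" for i x y
    by (rule funpow_add_hom) (simp add: mult_lambda_add mult_D_add algebra_simps)
  have Fh: "(?F ^^ i) (?h x) = ?h ((?F ^^ i) x)" for i x
    by (rule funpow_commute_hom) (simp add: mult_lambda_scale poly_poly_scale_minus)
  have Gh: "(?G ^^ i) (?h x) = ?h ((?G ^^ i) x)" for i x
    by (rule funpow_commute_hom) (simp add: mult_lambda_scale mult_D_scale poly_poly_scale_add)
  have h_sum: "(\<Sum>i\<in>I. ?h (f i)) = ?h (sum f I)" for f :: "nat \<Rightarrow> 'a poly poly" and I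
    by (rule additive_sum[symmetric]) (rule poly_poly_scale_add)
  let ?m = "max (Polynomial.degree p) (Polynomial.degree p')"
  let ?n = "max (Polynomial.degree q) (Polynomial.degree q')"
  have "Polynomial.degree (p + p') \<le> ?m" by (rule degree_add_le_max)
  then show "bracket left right (p + p') q = bracket left right p q + bracket left right p' q"
    by (simp add: bracket_bound[of _ ?m q "Polynomial.degree q"] bracket_gen_linear F G sum.distrib)
  have "Polynomial.degree (q + q') \<le> ?n" by (rule degree_add_le_max)
  then show "bracket left right p (q + q') = bracket left right p q + bracket left right p q'"
    by (simp add: bracket_bound[of p "Polynomial.degree p" _ ?n] bracket_gen_linear F G sum.distrib)
  show "bracket left right (cur_scale scale t p) q = ?h (bracket left right p q)"
    by (simp add: bracket_bound[of _ "Polynomial.degree p" q "Polynomial.degree q"]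
        degree_cur_scale_le bracket_gen_linear Fh Gh h_sum)
  show "bracket left right p (cur_scale scale t q) = ?h (bracket left right p q)"
    by (simp add: bracket_bound[of p "Polynomial.degree p" _ "Polynomial.degree q"]
        degree_cur_scale_le bracket_gen_linear Fh Gh h_sum)
qed


section \<open>Both equations tested by forms\<close>

lemma eval3_cdn_term:
  assumes "trilinear_form scale T"
  shows "eval3 T (cdn_term left right (a, b) (a', b')) =
    T (right a a') b b' + (T a (right b a') b' - T a (left b a') b')
      + (T a a' (right b' b) + T a a' (left b b'))"
  by (simp add: cdn_term_def trilinear_form_simps[OF assms])

lemma bilinear_form_cdn_term:
  assumes T: "trilinear_form scale T"
  shows "bilinear_form scale (\<lambda>a b. eval3 T (cdn_term left right (a, b) q))"
    and "bilinear_form scale (\<lambda>a b. eval3 T (cdn_term left right q (a, b)))"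
proof -
  obtain u v where q: "q = (u, v)" by (cases q)
  show "bilinear_form scale (\<lambda>a b. eval3 T (cdn_term left right (a, b) q))"
    "bilinear_form scale (\<lambda>a b. eval3 T (cdn_term left right q (a, b)))"
    unfolding q eval3_cdn_term[OF T]
    by (auto intro!: bilinear_formI simp: trilinear_form_simps[OF T] product_linear algebra_simps)
qed

abbreviation br :: "'a poly \<Rightarrow> 'a poly \<Rightarrow> 'a poly poly" where "br \<equiv> bracket left right"

lemma has_transpose_cur_D:
  "has_transpose (cur_scale scale) (d1 cur_D)"
  "has_transpose (cur_scale scale) (d2 cur_D)"
  "has_transpose (cur_scale scale) (\<lambda>x. - d1 cur_D x - d2 cur_D x)"
  "has_transpose (cur_scale scale) (\<lambda>x. d1 cur_D x + d2 cur_D x + d3 cur_D x)"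
  by (intro has_transpose_derivations cur_D_add cur_D_scale)+

lemma quad_ext_clc_cong:
  assumes "(x, y) \<in> cong2 (cur_scale scale)"
  shows "(quad_ext (clc_term cur_D br) x, quad_ext (clc_term cur_D br) y) \<in> cong3 (cur_scale scale)"
  using assms
proof (rule quad_ext_cong)
  fix T :: "'a poly \<Rightarrow> 'a poly \<Rightarrow> 'a poly \<Rightarrow> 'k" and q :: "'a poly \<times> 'a poly"
  assume T: "trilinear_form (cur_scale scale) T"
  obtain u v where q: "q = (u, v)" by (cases q)
  note lin = eval3_subst_op_linear[OF has_transpose_cur_D(2) T trilinear_insertion_e3(1) cur_scale_zero]
    eval3_subst_op_linear[OF has_transpose_cur_D(2) T trilinear_insertion_e3(3) cur_scale_zero]
    eval3_subst_op_linear[OF has_transpose_cur_D(1) T trilinear_insertion_e3(2) cur_scale_zero]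
    eval3_subst_op_linear[OF has_transpose_cur_D(3) T trilinear_insertion_e3(2) cur_scale_zero]
  show "bilinear_form (cur_scale scale) (\<lambda>a b. eval3 T (clc_term cur_D br (a, b) q))"
    "bilinear_form (cur_scale scale) (\<lambda>a b. eval3 T (clc_term cur_D br q (a, b)))"
    unfolding q clc_term_def
    by (auto intro!: bilinear_formI simp: lin bracket_linear algebra_simps)
qed


text \<open>
  The degree bound 1 is used for all brackets of constants, although the coefficient of \<open>\<lambda>\<close>
  may vanish.
\<close>

lemma eval3_clc_term_const:
  assumes T: "trilinear_form (cur_scale scale) T"
  shows "eval3 T (clc_term cur_D br ([:a:], [:b:]) ([:a':], [:b':])) =
      T (cur_D [:left a' a:]) [:b:] [:b':] + T [:right a a' + left a' a:] (cur_D [:b:]) [:b':]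
    + T [:a:] [:a':] (cur_D [:left b b':]) + T [:a:] (cur_D [:a':]) [:right b' b + left b b':]
    - T [:a:] (cur_D [:left a' b:]) [:b':] - T (cur_D [:a:]) [:right b a' + left a' b:] [:b':]
    - T [:a:] (cur_D [:left b a':]) [:b':]
    + T (cur_D [:a:]) [:right a' b + left b a':] [:b':]
    + T [:a:] (cur_D [:right a' b + left b a':]) [:b':]"
proof -
  have deg: "Polynomial.degree (bracket_gen left right u v) \<le> 1" for u v
    by (simp add: bracket_gen_def)
  note subst = eval3_subst_op[OF has_transpose_cur_D(2) T trilinear_insertion_e3(1) deg]
    eval3_subst_op[OF has_transpose_cur_D(2) T trilinear_insertion_e3(3) deg]
    eval3_subst_op[OF has_transpose_cur_D(1) T trilinear_insertion_e3(2) deg]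
    eval3_subst_op[OF has_transpose_cur_D(3) T trilinear_insertion_e3(2) deg]
  show ?thesis
    by (simp add: clc_term_def bracket_const subst) (simp add: bracket_gen_def)
qed

lemma const_add: "[:a + b:] = [:a:] + [:b:]" "[:a - b:] = [:a:] - [:b:]" for a b :: 'a
  by simp_all

lemma trilinear_form_const:
  assumes T: "trilinear_form (cur_scale scale) T"
  shows "trilinear_form scale (\<lambda>a b c. T (cur_D [:a:]) [:b:] [:c:])"
    and "trilinear_form scale (\<lambda>a b c. T [:a:] (cur_D [:b:]) [:c:])"
    and "trilinear_form scale (\<lambda>a b c. T [:a:] [:b:] (cur_D [:c:]))"
proof -
  have const_scale: "[:scale t a:] = cur_scale scale t [:a:]" for t a
    by (simp add: poly_eq_iff coeff_pCons split: nat.split)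
  show "trilinear_form scale (\<lambda>a b c. T (cur_D [:a:]) [:b:] [:c:])"
    "trilinear_form scale (\<lambda>a b c. T [:a:] (cur_D [:b:]) [:c:])"
    "trilinear_form scale (\<lambda>a b c. T [:a:] [:b:] (cur_D [:c:]))"
    by (auto intro!: trilinear_formI simp: const_add const_scale cur_D_add cur_D_scale
        trilinear_form_simps[OF T] simp del: add_pCons)
qed


text \<open>
  The congruence \<open>[[r,r]] = \<partial>\<^sub>1 (\<sigma> N(r) - N(r)) + \<partial>\<^sub>2 (\<sigma> N(r)) + (\<partial>\<^sub>1 + \<partial>\<^sub>2 + \<partial>\<^sub>3) Z\<close>, tested by a
  form \<open>T\<close>.  The form \<open>T(\<partial>c, b, a)\<close> of \<open>a, b, c\<close> evaluates \<open>T\<close> on \<open>\<partial>\<^sub>1 \<sigma>(a \<otimes> b \<otimes> c)\<close>, and the other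
  forms on the right-hand side arise in the same way.
\<close>

lemma eval3_clc_modulo_total_derivative:
  assumes T: "trilinear_form (cur_scale scale) T"
    and r_sym: "(lin_ext (\<lambda>(a, b). e2 b a) x, x) \<in> cong2 scale"
  defines "N \<equiv> quad_ext (cdn_term left right) x"
    and "z \<equiv> quad_ext (\<lambda>(a, b) (a', b'). e3 [:a:] [:a':] [:left b b':]) x"
  shows "eval3 T (quad_ext (clc_term cur_D br) (lin_ext (\<lambda>(a, b). e2 [:a:] [:b:]) x)) =
      eval3 (\<lambda>a b c. T (cur_D [:c:]) [:b:] [:a:]) N - eval3 (\<lambda>a b c. T (cur_D [:a:]) [:b:] [:c:]) N
    + eval3 (\<lambda>a b c. T [:c:] (cur_D [:b:]) [:a:]) N
    + eval3 T (d1 cur_D z + d2 cur_D z + d3 cur_D z)"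
proof -
  note tri = trilinear_form_const[OF T]
  let ?T1 = "\<lambda>a b c. T (cur_D [:a:]) [:b:] [:c:]" and ?R1 = "\<lambda>a b c. T (cur_D [:c:]) [:b:] [:a:]"
  let ?R2 = "\<lambda>a b c. T [:c:] (cur_D [:b:]) [:a:]"
  have R: "trilinear_form scale ?R1" "trilinear_form scale ?R2"
    using trilinear_form_reverse[OF tri(1)] trilinear_form_reverse[OF tri(2)] by simp_all
  let ?I = "\<lambda>U a b a' b'. eval3 U (cdn_term left right (a, b) (a', b'))"
  let ?Z = "\<lambda>a b a' b'. T (cur_D [:a:]) [:a':] [:left b b':] + T [:a:] (cur_D [:a':]) [:left b b':]
      + T [:a:] [:a':] (cur_D [:left b b':])"
  let ?S = "\<lambda>F. eval2 (\<lambda>a b. eval2 (\<lambda>a' b'. F a b a' b') x) x"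
  have N: "eval3 U N = ?S (?I U)" for U
    by (simp add: N_def case_prod_unfold)
  have flipped: "eval3 U N = ?S (\<lambda>a b a' b'. ?I U b' a' b a)" if "trilinear_form scale U" for U
    unfolding N using double_sum_flip[OF r_sym, of "?I U"] bilinear_form_cdn_term[OF that] by blast
  \<comment> \<open>After reversing \<open>a, b, a', b'\<close> in the two flipped expressions, both sides agree summand by
    summand.\<close>
  have pointwise: "eval3 T (clc_term cur_D br ([:a:], [:b:]) ([:a':], [:b':])) =
      ?I ?R1 b' a' b a - ?I ?T1 a b a' b' + ?I ?R2 b' a' b a + ?Z a b a' b'" for a b a' b'
    unfolding eval3_clc_term_const[OF T] eval3_cdn_term[OF tri(1)] eval3_cdn_term[OF R(1)]
      eval3_cdn_term[OF R(2)]
    by (simp add: const_add cur_D_add trilinear_form_simps[OF T] del: add_pCons)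
  have "eval3 T (quad_ext (clc_term cur_D br) (lin_ext (\<lambda>(a, b). e2 [:a:] [:b:]) x)) =
      ?S (\<lambda>a b a' b'. eval3 T (clc_term cur_D br ([:a:], [:b:]) ([:a':], [:b':])))"
    by (simp add: case_prod_unfold)
  also have "\<dots> = ?S (\<lambda>a b a' b'. ?I ?R1 b' a' b a) - ?S (?I ?T1)
      + ?S (\<lambda>a b a' b'. ?I ?R2 b' a' b a) + ?S ?Z"
    unfolding pointwise by (simp only: case_prod_unfold form_ext_fun_add form_ext_fun_diff)
  also have "?S ?Z = eval3 T (d1 cur_D z + d2 cur_D z + d3 cur_D z)"
    by (simp add: z_def case_prod_unfold form_ext_fun_add)
  finally show ?thesis
    unfolding flipped[OF R(1)] flipped[OF R(2)] N[of ?T1] .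
qed

lemma CDNYBE_class_iff:
  "CDNYBE scale left right (cong2 scale `` {x}) \<longleftrightarrow>
     (\<forall>U. trilinear_form scale U \<longrightarrow> eval3 U (quad_ext (cdn_term left right) x) = 0)"
proof -
  have "CDN scale left right (cong2 scale `` {x}) =
      cong3 scale `` {quad_ext (cdn_term left right) x}"
    unfolding CDN_def using bilinear_form_cdn_term
    by (intro quot_lift_class equiv_cong2 equiv_cong3 quad_ext_cong)
  then show ?thesis
    unfolding CDNYBE_def by (simp add: eq_equiv_class_iff[OF equiv_cong3] cong3_iff)
qed

lemma CLCYBE_class_iff:
  "CLCYBE (cur_scale scale) cur_D br (cong2 (cur_scale scale) `` {y}) \<longleftrightarrow>
     (\<exists>z. (quad_ext (clc_term cur_D br) y, d1 cur_D z + d2 cur_D z + d3 cur_D z)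
        \<in> cong3 (cur_scale scale))"
proof -
  let ?R = "cong3 (cur_scale scale)"
  let ?D = "\<lambda>z :: ('a poly \<times> 'a poly \<times> 'a poly) \<Rightarrow>\<^sub>0 'k. d1 cur_D z + d2 cur_D z + d3 cur_D z"
  have "CLC (cur_scale scale) cur_D br (cong2 (cur_scale scale) `` {y}) =
      ?R `` {quad_ext (clc_term cur_D br) y}"
    unfolding CLC_def by (intro quot_lift_class equiv_cong2 equiv_cong3 quad_ext_clc_cong)
  moreover have "quot_lift ?R ?D (?R `` {z}) = ?R `` {?D z}" for z
    by (intro quot_lift_class equiv_cong3 has_transpose_cong3[OF has_transpose_cur_D(4)])
  then have "quot_lift ?R ?D ` tensor3 (cur_scale scale) = {?R `` {?D z} | z. True}"
    unfolding tensor3_def quotient_def by auto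
  ultimately show ?thesis
    unfolding CLCYBE_def by (auto simp: eq_equiv_class_iff[OF equiv_cong3])
qed

text \<open>
  A bilinear form on \<open>k[\<partial>] \<otimes> A\<close> restricts to one on the constants, so the inclusion of constants is
  well defined on tensors.
\<close>

lemma cur_incl2_class:
  "cur_incl2 scale (cong2 scale `` {x}) =
     cong2 (cur_scale scale) `` {lin_ext (\<lambda>(a, b). e2 [:a:] [:b:]) x}"
  unfolding cur_incl2_def
proof (intro quot_lift_class equiv_cong2)
  fix y assume xy: "(x, y) \<in> cong2 scale"
  have "bilinear_form scale (\<lambda>a b. B [:a:] [:b:])" if "bilinear_form (cur_scale scale) B" for B
  proof -
    have const_scale: "[:scale t a:] = cur_scale scale t [:a:]" for t a
      by (simp add: poly_eq_iff coeff_pCons split: nat.split)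
    show ?thesis
      using that by (simp add: bilinear_form_def linear_form_def const_add const_scale del: add_pCons)
  qed
  then show "(lin_ext (\<lambda>(a, b). e2 [:a:] [:b:]) x, lin_ext (\<lambda>(a, b). e2 [:a:] [:b:]) y)
      \<in> cong2 (cur_scale scale)"
    unfolding cong2_iff using form_ext_cong2[OF xy] by (simp add: case_prod_unfold)
qed

text \<open>
  Substituting \<open>\<partial>\<^sub>3 = - \<partial>\<^sub>1 - \<partial>\<^sub>2\<close> in \<open>\<partial>\<^sub>1\<^sup>i \<partial>\<^sub>2\<^sup>j \<partial>\<^sub>3\<^sup>k\<close> gives a polynomial whose coefficient of
  \<open>\<partial>\<^sub>2\<close> is \<open>1\<close> for \<open>(i, j, k) = (0, 1, 0)\<close>, \<open>- 1\<close> for \<open>(0, 0, 1)\<close> and \<open>0\<close> otherwise.  The form below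
  applies \<open>U\<close> to this coefficient, so it vanishes on total derivatives.
\<close>

lemma trilinear_form_detect_D2:
  assumes "trilinear_form scale U"
  shows "trilinear_form (cur_scale scale)
    (\<lambda>p q s. U (coeff p 0) (coeff q 1) (coeff s 0) - U (coeff p 0) (coeff q 0) (coeff s 1))"
  by (auto intro!: trilinear_formI simp: trilinear_form_simps[OF assms] algebra_simps)

lemma CLCYBE_iff_CDNYBE:
  assumes r: "r \<in> tensor2 scale" and "tensor_symmetric scale r"
  shows "CLCYBE (cur_scale scale) cur_D br (cur_incl2 scale r) \<longleftrightarrow> CDNYBE scale left right r"
proof -
  obtain x where x: "r = cong2 scale `` {x}"
    using r unfolding tensor2_def quotient_def by auto
  have "quot_lift (cong2 scale) (lin_ext (\<lambda>(a, b). e2 b a)) r =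
      cong2 scale `` {lin_ext (\<lambda>(a, b). e2 b a) x}"
    unfolding x
  proof (intro quot_lift_class equiv_cong2)
    fix y assume xy: "(x, y) \<in> cong2 scale"
    show "(lin_ext (\<lambda>(a, b). e2 b a) x, lin_ext (\<lambda>(a, b). e2 b a) y) \<in> cong2 scale"
      unfolding cong2_iff using form_ext_cong2[OF xy]
      by (simp add: case_prod_unfold bilinear_form_def)
  qed
  with \<open>tensor_symmetric scale r\<close> have r_sym: "(lin_ext (\<lambda>(a, b). e2 b a) x, x) \<in> cong2 scale"
    unfolding tensor_symmetric_def x by (simp add: eq_equiv_class_iff[OF equiv_cong2])
  let ?N = "quad_ext (cdn_term left right) x"
  let ?y = "lin_ext (\<lambda>(a, b). e2 [:a:] [:b:]) x"
  let ?D = "\<lambda>z :: ('a poly \<times> 'a poly \<times> 'a poly) \<Rightarrow>\<^sub>0 'k. d1 cur_D z + d2 cur_D z + d3 cur_D z"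
  note clc = eval3_clc_modulo_total_derivative[OF _ r_sym]
  have "(\<exists>z. (quad_ext (clc_term cur_D br) ?y, ?D z) \<in> cong3 (cur_scale scale)) \<longleftrightarrow>
      (\<forall>U. trilinear_form scale U \<longrightarrow> eval3 U ?N = 0)"
  proof (intro iffI allI impI)
    assume N: "\<forall>U. trilinear_form scale U \<longrightarrow> eval3 U ?N = 0"
    show "\<exists>z. (quad_ext (clc_term cur_D br) ?y, ?D z) \<in> cong3 (cur_scale scale)"
      unfolding cong3_iff
    proof (intro exI allI impI)
      fix T :: "'a poly \<Rightarrow> 'a poly \<Rightarrow> 'a poly \<Rightarrow> 'k"
      assume T: "trilinear_form (cur_scale scale) T"
      note tri = trilinear_form_const(1,2)[OF T]
      show "eval3 T (quad_ext (clc_term cur_D br) ?y) =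
          eval3 T (?D (quad_ext (\<lambda>(a, b) (a', b'). e3 [:a:] [:a':] [:left b b':]) x))"
        unfolding clc[OF T]
        using N[rule_format, OF tri(1)] N[rule_format, OF trilinear_form_reverse[OF tri(1)]]
          N[rule_format, OF trilinear_form_reverse[OF tri(2)]]
        by simp
    qed
  next
    fix V assume "\<exists>z. (quad_ext (clc_term cur_D br) ?y, ?D z) \<in> cong3 (cur_scale scale)"
      and V: "trilinear_form scale V"
    then obtain z where z: "(quad_ext (clc_term cur_D br) ?y, ?D z) \<in> cong3 (cur_scale scale)"
      by blast
    \<comment> \<open>The coefficient of \<open>\<partial>\<^sub>2\<close> is \<open>\<sigma> N(r)\<close>; testing it with \<open>V\<close> in reversed order of arguments
      tests \<open>N(r)\<close> with \<open>V\<close>.\<close>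
    let ?T = "\<lambda>p q s. V (coeff s 0) (coeff q 1) (coeff p 0) - V (coeff s 1) (coeff q 0) (coeff p 0)"
    have T: "trilinear_form (cur_scale scale) ?T"
      using trilinear_form_detect_D2[OF trilinear_form_reverse[OF V]] by simp
    note zero = trilinear_form_zero[OF V]
    \<comment> \<open>\<open>\<partial>\<close> shifts coefficients and leaves \<open>0\<close> as constant term: of the six summands four
      vanish and the other two cancel.\<close>
    have total: "eval3 ?T (?D w) = 0" for w
      by (simp add: cur_D_def zero case_prod_unfold flip: form_ext_fun_add)
        (simp add: form_ext_def)
    have "eval3 ?T (quad_ext (clc_term cur_D br) ?y) = eval3 ?T (?D z)"
      using z T unfolding cong3_iff by blast
    then have "0 = eval3 ?T (quad_ext (clc_term cur_D br) ?y)"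
      unfolding total by (rule sym)
    also have "\<dots> = eval3 V ?N"
      unfolding clc[OF T] total
      by (simp add: cur_D_def zero)
    finally show "eval3 V ?N = 0" by simp
  qed
  then show ?thesis
    unfolding x cur_incl2_class CLCYBE_class_iff CDNYBE_class_iff .
qed

end

theorem proposition5p8:
  fixes scale :: "'k::field_char_0 \<Rightarrow> 'a::ab_group_add \<Rightarrow> 'a"
    and left right :: "'a \<Rightarrow> 'a \<Rightarrow> 'a"
    and r :: "(('a \<times> 'a) \<Rightarrow>\<^sub>0 'k) set"
  assumes "\<exists>Basis. finite_dimensional_vector_space scale Basis"
    and "novikov_dialgebra scale left right"
    and "r \<in> tensor2 scale"
    and "tensor_symmetric scale r"
  shows "CLCYBE (cur_scale scale) cur_D (bracket left right) (cur_incl2 scale r)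
     \<longleftrightarrow> CDNYBE scale left right r"
  using novikov_dialgebra.CLCYBE_iff_CDNYBE[OF assms(2-4)] .

end
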